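(* Let $\ell$ be a positive integer. Then $$I(\mathbb{A}^4_G(\mathbb{F}_q))=\langle x_3x_1f_1,\; x_4x_2x_1f_2,\; x_4x_3x_2f_3\rangle,$$ where $f_1=x_3^{q-1}-x_1^{q-1}$, $f_2=x_4^{q-1}-x_2^{q-1}x_1^{(q-1)\ell}$ and $f_3=x_4^{q-1}-x_3^{(q-1)\ell}x_2^{q-1}$.
   Context: $\mathbb{F}_q$ is a finite field, $\mathbb{K}=\overline{\mathbb{F}}_q$ an algebraic closure. $S=\mathbb{F}_q[x_1,x_2,x_3,x_4]$ is $\mathbb{Z}^2$-graded by $\deg(x_1)=\deg(x_3)=(1,0)$, $\deg(x_2)=(0,1)$, $\deg(x_4)=(\ell,1)$ (this is the Cox ring of the Hirzebruch surface $\mathcal{H}_\ell$); "homogeneous" refers to this grading. The group $G=\{(t_1,t_2,t_1,t_1^{\ell}t_2):t_1,t_2\in\mathbb{K}^*\}$ acts on $\mathbb{K}^4$ by coordinatewise multiplication, and $\mathbb{A}^4_G(\mathbb{F}_q)=\mathbb{F}_q^4/G$ is the set of $G$-orbits $[P]=G\cdot P$ of points $P\in\mathbb{F}_q^4$. For a set $Y_G$ of such orbits, $I(Y_G)\subseteq S$ is the ideal generated by the homogeneous polynomials in $S$ vanishing at all $P$ with $[P]\in Y_G$ (for homogeneous $F$, vanishing at $P$ depends only on $[P]$). *)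

theory Defs
  imports
    "HOL-Analysis.Cartesian_Space"
    "HOL-Algebra.Algebraic_Closure_Type"
    "HOL-Library.Poly_Mapping"
begin

unbundle no fps_syntax

text \<open>
  Polynomials in four variables: finitely supported maps from exponent vectors to coefficients,
  with the convolution product. The index type \<open>4\<close> has the elements 1, 2, 3, 4
  (with \<open>4 = 0\<close> in that type).
\<close>

type_synonym 'a poly4 = "(4 \<Rightarrow>\<^sub>0 nat) \<Rightarrow>\<^sub>0 'a"

definition Var :: "4 \<Rightarrow> 'a::comm_ring_1 poly4" where
  "Var i = Poly_Mapping.single (Poly_Mapping.single i 1) 1"

definition monom_degree :: "nat \<Rightarrow> (4 \<Rightarrow>\<^sub>0 nat) \<Rightarrow> int \<times> int" where
  "monom_degree l m =
     (int (Poly_Mapping.lookup m 1) + int (Poly_Mapping.lookup m 3) + int l * int (Poly_Mapping.lookup m 4),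
      int (Poly_Mapping.lookup m 2) + int (Poly_Mapping.lookup m 4))"

definition homogeneous :: "nat \<Rightarrow> 'a::comm_ring_1 poly4 \<Rightarrow> bool" where
  "homogeneous l F \<longleftrightarrow> (\<exists>d. \<forall>m\<in>Poly_Mapping.keys F. monom_degree l m = d)"

definition eval4 :: "'a::field poly4 \<Rightarrow> 'a alg_closure ^ 4 \<Rightarrow> 'a alg_closure" where
  "eval4 F P = (\<Sum>m\<in>Poly_Mapping.keys F. to_ac (Poly_Mapping.lookup F m) * (\<Prod>i\<in>UNIV. P $ i ^ Poly_Mapping.lookup m i))"

definition group_G :: "nat \<Rightarrow> ('a::field alg_closure ^ 4) set" where
  "group_G l = {vector [t1, t2, t1, t1 ^ l * t2] | t1 t2. t1 \<noteq> 0 \<and> t2 \<noteq> 0}"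

text \<open>The product of vectors is coordinatewise multiplication.\<close>

definition G_orbit :: "nat \<Rightarrow> 'a::field alg_closure ^ 4 \<Rightarrow> ('a alg_closure ^ 4) set" where
  "G_orbit l P = {t * P | t. t \<in> group_G l}"

definition embed_point :: "'a::field ^ 4 \<Rightarrow> 'a alg_closure ^ 4" where
  "embed_point P = (\<chi> i. to_ac (P $ i))"

definition A4_G :: "nat \<Rightarrow> ('a::field alg_closure ^ 4) set set" where
  "A4_G l = {G_orbit l (embed_point P) | P. True}"

text \<open>The ideal generated by a set is its span in the ring regarded as a module over itself.\<close>

lemma module_mult: "Modules.module ((*) :: 'a::comm_ring_1 \<Rightarrow> 'a \<Rightarrow> 'a)"
  by unfold_locales (simp_all add: algebra_simps)

definition ideal_generated :: "'a::comm_ring_1 set \<Rightarrow> 'a set" where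
  "ideal_generated B = Modules.module.span (*) B"

definition vanishing_ideal ::
    "nat \<Rightarrow> ('a::field alg_closure ^ 4) set set \<Rightarrow> 'a poly4 set" where
  "vanishing_ideal l Y =
     ideal_generated {F. homogeneous l F \<and> (\<forall>P. G_orbit l P \<in> Y \<longrightarrow> eval4 F P = 0)}"

lemma prod_UNIV_4: "(\<Prod>i\<in>UNIV. f i) = f 1 * f 2 * f 3 * f (4::4)"
  for f :: "4 \<Rightarrow> 'b::comm_monoid_mult"
  unfolding UNIV_4 by (simp add: mult.assoc)

text \<open>
  For homogeneous \<open>F\<close>, vanishing at a point depends only on its orbit. Hence it makes no
  difference whether the points in \<open>vanishing_ideal\<close> are taken in the algebraic closure, as here,
  or only among the representatives with coordinates in the base field.
\<close>

lemma vanishing_depends_on_orbit: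
  fixes F :: "'a::field poly4" and P :: "'a alg_closure ^ 4"
  assumes "homogeneous l F" and "Q \<in> G_orbit l P"
  shows "eval4 F Q = 0 \<longleftrightarrow> eval4 F P = 0"
proof -
  from assms(2) obtain t1 t2 :: "'a alg_closure" where t: "t1 \<noteq> 0" "t2 \<noteq> 0"
    and Q: "Q = vector [t1, t2, t1, t1 ^ l * t2] * P"
    unfolding G_orbit_def group_G_def by blast
  have Qi: "Q $ 1 = t1 * P $ 1" "Q $ 2 = t2 * P $ 2" "Q $ 3 = t1 * P $ 3"
    "Q $ 4 = (t1 ^ l * t2) * P $ 4"
    unfolding Q by (simp_all add: vector_def)
  from assms(1) obtain d where d: "\<And>m. m \<in> Poly_Mapping.keys F \<Longrightarrow> monom_degree l m = d"
    unfolding homogeneous_def by blast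
  define a b where "a = nat (fst d)" and "b = nat (snd d)"
  have "eval4 F Q = (t1 ^ a * t2 ^ b) * eval4 F P"
    unfolding eval4_def sum_distrib_left
  proof (rule sum.cong)
    fix m assume m: "m \<in> Poly_Mapping.keys F"
    define n where "n = Poly_Mapping.lookup m"
    have a: "a = n 1 + n 3 + l * n 4" and b: "b = n 2 + n 4"
      unfolding a_def b_def d[OF m, symmetric] monom_degree_def n_def
      by (simp_all flip: of_nat_add of_nat_mult)
    have "(\<Prod>i\<in>UNIV. Q $ i ^ n i) = (t1 ^ a * t2 ^ b) * (\<Prod>i\<in>UNIV. P $ i ^ n i)"
      unfolding prod_UNIV_4 Qi a b power_mult_distrib power_add power_mult by (simp only: mult_ac)
    then show "to_ac (Poly_Mapping.lookup F m) * (\<Prod>i\<in>UNIV. Q $ i ^ Poly_Mapping.lookup m i) =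
        (t1 ^ a * t2 ^ b) * (to_ac (Poly_Mapping.lookup F m) *
          (\<Prod>i\<in>UNIV. P $ i ^ Poly_Mapping.lookup m i))"
      unfolding n_def by (simp only: mult_ac)
  qed simp
  with t show ?thesis by simp
qed

end

theory Submission
  imports Defs
begin

unbundle no fps_syntax

text \<open>
  On points over the base field, two monomials agree as functions if and only if they have the same
  support and their exponents agree modulo \<open>q - 1\<close>, and the distinct functions arising in this way
  are linearly independent. Hence a homogeneous \<open>F\<close> vanishing on all points is a combination of
  differences of monomials of the same degree in the same class. Such a difference lies in the ideal:
  if the exponents of \<open>x4\<close> differ, then \<open>x4\<close>, \<open>x2\<close> and one of \<open>x1\<close>, \<open>x3\<close> occur in both monomials,
  and \<open>f2\<close> or \<open>f3\<close> makes these exponents equal; the rest is a multiple of a difference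
  \<open>x3 ^ (k (q - 1)) - x1 ^ (k (q - 1))\<close>.
\<close>

section \<open>Ideals generated by a set\<close>

text \<open>
  The module locale is not interpreted: its simp rule \<open>scale_scale\<close> would become
  \<open>a * (b * x) = a * b * x\<close> and loop with the rearrangement rules for products.
\<close>

lemmas ideal_base = module.span_base[OF module_mult, folded ideal_generated_def]
  and ideal_zero = module.span_zero[OF module_mult, folded ideal_generated_def]
  and ideal_add = module.span_add[OF module_mult, folded ideal_generated_def]
  and ideal_neg = module.span_neg[OF module_mult, folded ideal_generated_def]
  and ideal_scale = module.span_scale[OF module_mult, folded ideal_generated_def]
  and ideal_sum = module.span_sum[OF module_mult, folded ideal_generated_def]
  and ideal_mono = module.span_mono[OF module_mult, folded ideal_generated_def]
  and ideal_minimal = module.span_minimal[OF module_mult _ module.subspace_span[OF module_mult],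
    folded ideal_generated_def]

lemma ideal_generated_diff_trans:
  fixes u v w :: "'a::comm_ring_1"
  assumes "u - v \<in> ideal_generated B" "v - w \<in> ideal_generated B"
  shows "u - w \<in> ideal_generated B"
  using ideal_add[OF assms] by simp

lemma ideal_generated_diff_commute:
  fixes u v :: "'a::comm_ring_1"
  assumes "u - v \<in> ideal_generated B"
  shows "v - u \<in> ideal_generated B"
  using ideal_neg[OF assms] by simp

text \<open>Since \<open>u - v\<close> divides \<open>u ^ k - v ^ k\<close>, a single generator
  \<open>g * (u - v)\<close> handles every \<open>k\<close>. The factor \<open>h\<close> will be the
  rest of a monomial.\<close>

lemma ideal_generated_diff_powers:
  fixes u v g h :: "'a::comm_ring_1"
  assumes "g * (u - v) \<in> B"
  shows "h * (g * (u ^ k - v ^ k)) \<in> ideal_generated B"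
proof -
  have "u ^ k - v ^ k = (u - v) * (\<Sum>i<k. v ^ (k - Suc i) * u ^ i)"
    by (rule power_diff_sumr2)
  then have "h * (g * (u ^ k - v ^ k)) =
      (h * (\<Sum>i<k. v ^ (k - Suc i) * u ^ i)) * (g * (u - v))"
    by (simp only: mult_ac)
  then show ?thesis
    using ideal_scale[OF ideal_base[OF assms]] by metis
qed

section \<open>Reduction of exponents\<close>

text \<open>
  On a field with \<open>p + 1\<close> elements, \<open>x ^ e\<close> and \<open>x ^ red_exp p e\<close> agree as functions. The exponent
  \<open>0\<close> has to be kept apart because of \<open>x = 0\<close>.
\<close>

definition red_exp :: "nat \<Rightarrow> nat \<Rightarrow> nat" where
  "red_exp p e = (if e = 0 then 0 else Suc ((e - 1) mod p))"

lemma red_exp_eq_0_iff: "red_exp p e = 0 \<longleftrightarrow> e = 0"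
  by (simp add: red_exp_def)

lemma red_exp_add_mult: "e > 0 \<Longrightarrow> red_exp p (e + k * p) = red_exp p e"
  by (cases e) (simp_all add: red_exp_def)

lemma red_exp_eqD:
  assumes "red_exp p e = red_exp p e'" "e \<le> e'"
  obtains k where "e' = e + k * p"
proof (cases "e = 0")
  case True
  then show ?thesis
    using assms that[of 0] by (metis add_0 mult_0 red_exp_eq_0_iff)
next
  case False
  then have "e' \<noteq> 0"
    using assms(2) by simp
  then have "(e' - 1) mod p = (e - 1) mod p"
    using assms(1) False by (simp add: red_exp_def)
  then obtain k where "e' - 1 = e - 1 + p * k"
    by (rule mod_eq_nat1E) (use assms(2) in simp)
  then show ?thesis
    using that[of k] False \<open>e' \<noteq> 0\<close> by (simp add: mult.commute)
qed

section \<open>Monomials modulo the three generators\<close>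

context
  fixes x1 x2 x3 x4 :: "'a::comm_ring_1" and l p :: nat and B :: "'a set"
    and mon :: "nat \<Rightarrow> nat \<Rightarrow> nat \<Rightarrow> nat \<Rightarrow> 'a"
  defines "B \<equiv> {x3 * x1 * (x3 ^ p - x1 ^ p),
    x4 * x2 * x1 * (x4 ^ p - x2 ^ p * x1 ^ (p * l)),
    x4 * x3 * x2 * (x4 ^ p - x3 ^ (p * l) * x2 ^ p)}"
  defines "mon \<equiv> \<lambda>a b c d. x1 ^ a * x2 ^ b * x3 ^ c * x4 ^ d"
begin

text \<open>Positivity of \<open>a\<close> and \<open>c\<close> lets one factor \<open>x1\<close>
  and one factor \<open>x3\<close> be split off, as the first generator requires; what remains is a
  difference of \<open>k\<close>-th powers.\<close>

lemma shift_13: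
  assumes "a > 0" "c > 0"
  shows "mon a b (c + k * p) d - mon (a + k * p) b c d \<in> ideal_generated B"
proof -
  obtain a' where a: "a = Suc a'" using assms(1) by (cases a) simp_all
  obtain c' where c: "c = Suc c'" using assms(2) by (cases c) simp_all
  have pow: "(x3 ^ p) ^ k = x3 ^ (k * p)" "(x1 ^ p) ^ k = x1 ^ (k * p)"
    by (simp_all only: power_mult[symmetric] mult.commute)
  have "mon a b (c + k * p) d - mon (a + k * p) b c d =
      mon a' b c' d * (x3 * x1 * ((x3 ^ p) ^ k - (x1 ^ p) ^ k))"
    unfolding pow a c mon_def by (simp add: power_add algebra_simps)
  moreover have "\<dots> \<in> ideal_generated B"
    by (rule ideal_generated_diff_powers) (simp add: B_def)
  ultimately show ?thesis by simp
qed

text \<open>The exchange of \<open>x4 ^ p\<close> for \<open>x2 ^ p * x1 ^ (p * l)\<close> given by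
  the second generator, carried out \<open>k\<close> times; the third generator gives the same with
  \<open>x3\<close> in place of \<open>x1\<close>.\<close>

lemma shift_124:
  assumes "a > 0" "b > 0" "d > 0"
  shows "mon a b c (d + k * p) - mon (a + k * l * p) (b + k * p) c d \<in> ideal_generated B"
proof -
  obtain a' where a: "a = Suc a'" using assms(1) by (cases a) simp_all
  obtain b' where b: "b = Suc b'" using assms(2) by (cases b) simp_all
  obtain d' where d: "d = Suc d'" using assms(3) by (cases d) simp_all
  have pow: "(x4 ^ p) ^ k = x4 ^ (k * p)"
      "(x2 ^ p * x1 ^ (p * l)) ^ k = x2 ^ (k * p) * x1 ^ (k * l * p)"
    by (simp_all only: power_mult_distrib power_mult[symmetric] mult_ac)
  have "mon a b c (d + k * p) - mon (a + k * l * p) (b + k * p) c d =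
      mon a' b' c d' * (x4 * x2 * x1 * ((x4 ^ p) ^ k - (x2 ^ p * x1 ^ (p * l)) ^ k))"
    unfolding pow a b d mon_def by (simp add: power_add algebra_simps)
  moreover have "\<dots> \<in> ideal_generated B"
    by (rule ideal_generated_diff_powers) (simp add: B_def)
  ultimately show ?thesis by simp
qed

lemma shift_234:
  assumes "b > 0" "c > 0" "d > 0"
  shows "mon a b c (d + k * p) - mon a (b + k * p) (c + k * l * p) d \<in> ideal_generated B"
proof -
  obtain b' where b: "b = Suc b'" using assms(1) by (cases b) simp_all
  obtain c' where c: "c = Suc c'" using assms(2) by (cases c) simp_all
  obtain d' where d: "d = Suc d'" using assms(3) by (cases d) simp_all
  have pow: "(x4 ^ p) ^ k = x4 ^ (k * p)"
      "(x3 ^ (p * l) * x2 ^ p) ^ k = x3 ^ (k * l * p) * x2 ^ (k * p)"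
    by (simp_all only: power_mult_distrib power_mult[symmetric] mult_ac)
  have "mon a b c (d + k * p) - mon a (b + k * p) (c + k * l * p) d =
      mon a b' c' d' * (x4 * x3 * x2 * ((x4 ^ p) ^ k - (x3 ^ (p * l) * x2 ^ p) ^ k))"
    unfolding pow b c d mon_def by (simp add: power_add algebra_simps)
  moreover have "\<dots> \<in> ideal_generated B"
    by (rule ideal_generated_diff_powers) (simp add: B_def)
  ultimately show ?thesis by simp
qed

lemma mon_diff_same_bd:
  assumes "red_exp p a = red_exp p a'" "red_exp p c = red_exp p c'" "a + c = a' + c'"
  shows "mon a b c d - mon a' b c' d \<in> ideal_generated B"
proof -
  have *: "mon a b c d - mon a' b c' d \<in> ideal_generated B"
    if hyps: "red_exp p a = red_exp p a'" "red_exp p c = red_exp p c'" "a + c = a' + c'" "c' \<le> c"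
    for a c a' c'
  proof (cases "c = c'")
    case True
    then show ?thesis
      using hyps ideal_zero by simp
  next
    case False
    obtain k where k: "c = c' + k * p"
      by (rule red_exp_eqD[OF hyps(2)[symmetric] hyps(4)])
    have "a' = a + k * p"
      using k hyps by simp
    \<comment> \<open>A class is 0 only for the exponent 0, so positivity passes from
      \<open>c\<close> to \<open>c'\<close> and from \<open>a'\<close> to \<open>a\<close>.\<close>
    moreover have "c > 0" "a' > 0"
      using False hyps(3,4) by linarith+
    then have "c' > 0" "a > 0"
      using red_exp_eq_0_iff[of p c] red_exp_eq_0_iff[of p c'] red_exp_eq_0_iff[of p a]
        red_exp_eq_0_iff[of p a'] hyps(1,2) by auto
    ultimately show ?thesis
      using shift_13 k by simp
  qed
  show ?thesis
    using *[OF assms] *[OF assms(1,2)[symmetric] assms(3)[symmetric]]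
      ideal_generated_diff_commute by (meson nle_le)
qed

text \<open>
  If the exponents of \<open>x4\<close> differ, then \<open>x1\<close> and \<open>x3\<close> cannot both be absent: as \<open>l > 0\<close>, the
  degree would force the exponents of \<open>x4\<close> to agree.
\<close>

lemma mon_diff_in_ideal:
  assumes "l > 0"
    and red: "red_exp p a = red_exp p a'" "red_exp p b = red_exp p b'"
      "red_exp p c = red_exp p c'" "red_exp p d = red_exp p d'"
    and deg: "a + c + l * d = a' + c' + l * d'" "b + d = b' + d'"
  shows "mon a b c d - mon a' b' c' d' \<in> ideal_generated B"
proof -
  have *: "mon a b c d - mon a' b' c' d' \<in> ideal_generated B"
    if red: "red_exp p a = red_exp p a'" "red_exp p b = red_exp p b'"
      "red_exp p c = red_exp p c'" "red_exp p d = red_exp p d'"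
    and deg: "a + c + l * d = a' + c' + l * d'" "b + d = b' + d'" and le: "d' \<le> d"
    for a b c d a' b' c' d'
  proof (cases "d = d'")
    case True
    then show ?thesis
      using mon_diff_same_bd[of a a' c c' b d] that by simp
  next
    case False
    obtain k where k: "d = d' + k * p"
      by (rule red_exp_eqD[OF red(4)[symmetric] le])
    with False have kp: "k * p > 0"
      by (intro gr0I) simp
    have b': "b' = b + k * p"
      using k deg by simp
    have ac: "a' + c' = a + c + k * l * p"
      using deg(1) by (simp add: k algebra_simps)
    have pos: "b > 0" "d' > 0"
      using red_exp_eq_0_iff[of p b] red_exp_eq_0_iff[of p b'] red_exp_eq_0_iff[of p d]
        red_exp_eq_0_iff[of p d'] red(2,4) b' k kp by auto
    show ?thesis
    proof (cases "a = 0")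
      case False
      \<comment> \<open>Lowering the exponent of \<open>x4\<close> to \<open>d'\<close> also turns
        \<open>b\<close> into \<open>b'\<close>, so only the exponents of \<open>x1\<close> and
        \<open>x3\<close> can still differ.\<close>
      have "mon a b c d - mon (a + k * l * p) b' c d' \<in> ideal_generated B"
        using shift_124[of a b d' c k] False pos by (simp add: k b')
      moreover have "mon (a + k * l * p) b' c d' - mon a' b' c' d' \<in> ideal_generated B"
        using red_exp_add_mult[of a p "k * l"] False red ac by (intro mon_diff_same_bd) simp_all
      ultimately show ?thesis
        by (rule ideal_generated_diff_trans)
    next
      case True
      then have a': "a' = 0"
        using red(1) red_exp_eq_0_iff by metis
      \<comment> \<open>Without \<open>x1\<close>, the first degree component puts the whole excess
        on \<open>x3\<close>, which is exactly the exchange in \<open>shift_234\<close>.\<close>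
      have c': "c' = c + k * l * p"
        using ac True a' by simp
      then have "c' > 0"
        using kp \<open>l > 0\<close> by simp
      then have "c > 0"
        using red(3) red_exp_eq_0_iff[of p c] red_exp_eq_0_iff[of p c'] by auto
      then show ?thesis
        using shift_234[of b c d' a k] pos unfolding a' c' b' k True by blast
    qed
  qed
  show ?thesis
  proof (cases "d' \<le> d")
    case True
    then show ?thesis by (rule *[OF red deg])
  next
    case False
    then have "mon a' b' c' d' - mon a b c d \<in> ideal_generated B"
      by (intro *[OF red[symmetric] deg[symmetric]]) simp
    then show ?thesis by (rule ideal_generated_diff_commute)
  qed
qed

end

section \<open>Power functions on a finite field\<close>

text \<open>Multiplication by \<open>x\<close> permutes the nonzero elements, so their product is
  unchanged by the factor \<open>x ^ (CARD('a) - 1)\<close> and can be cancelled.\<close>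

lemma power_card_minus_1_eq_1:
  fixes x :: "'a::{field, finite}"
  assumes "x \<noteq> 0"
  shows "x ^ (CARD('a) - 1) = 1"
proof -
  have "bij_betw ((*) x) (UNIV - {0}) (UNIV - {0})"
    by (rule bij_betw_byWitness[where f' = "\<lambda>y. y / x"]) (use assms in auto)
  then have "(\<Prod>y\<in>UNIV - {0}. x * y) = \<Prod>(UNIV - {0})"
    using prod.reindex_bij_betw[of "(*) x" "UNIV - {0}" "UNIV - {0}" "\<lambda>y. y"] by simp
  then have "x ^ (CARD('a) - 1) * \<Prod>(UNIV - {0 :: 'a}) = \<Prod>(UNIV - {0})"
    by (simp add: prod.distrib)
  moreover have "\<Prod>(UNIV - {0 :: 'a}) \<noteq> 0"
    by simp
  ultimately show ?thesis
    by simp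
qed

lemma card_field_gt_1: "CARD('a::{field, finite}) > 1"
  using card_mono[of UNIV "{0, 1 :: 'a}"] by simp

lemma power_red_exp:
  fixes x :: "'a::{field, finite}"
  assumes "p = CARD('a) - 1"
  shows "x ^ red_exp p e = x ^ e"
proof (cases "x = 0 \<or> e = 0")
  case True
  then show ?thesis
    by (auto simp: red_exp_def)
next
  case False
  have "x ^ (e - 1) = (x ^ p) ^ ((e - 1) div p) * x ^ ((e - 1) mod p)"
    by (metis mult_div_mod_eq power_add power_mult)
  also have "\<dots> = x ^ ((e - 1) mod p)"
    using False power_card_minus_1_eq_1[of x] assms by simp
  finally show ?thesis
    using False by (cases e) (simp_all add: red_exp_def)
qed

text \<open>This is linear independence in one variable. The class sums are the coefficients of a
  polynomial of degree at most \<open>p\<close>, which vanishes at all \<open>p + 1\<close> field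
  elements and hence is zero.\<close>

lemma sum_red_exp_eq_0:
  fixes h :: "'k \<Rightarrow> 'a::{field, finite}"
  assumes p: "p = CARD('a) - 1" and "finite K"
    and zero: "\<And>x. (\<Sum>m\<in>K. h m * x ^ e m) = 0"
  shows "(\<Sum>m | m \<in> K \<and> red_exp p (e m) = r. h m) = 0"
proof -
  define s where "s r = (\<Sum>m | m \<in> K \<and> red_exp p (e m) = r. h m)" for r
  define f where "f = (\<Sum>r\<le>p. monom (s r) r)"
  have "p > 0"
    using card_field_gt_1[where 'a = 'a] p by simp
  have le: "red_exp p e \<le> p" for e
    using \<open>p > 0\<close> by (auto simp: red_exp_def Suc_le_eq)
  have "poly f x = 0" for x
  proof -
    have "poly f x = (\<Sum>r\<le>p. \<Sum>m | m \<in> K \<and> red_exp p (e m) = r. h m * x ^ red_exp p (e m))"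
      by (simp add: f_def s_def poly_sum poly_monom sum_distrib_right)
    also have "\<dots> = (\<Sum>m\<in>K. h m * x ^ red_exp p (e m))"
      by (rule sum.group) (use \<open>finite K\<close> le in auto)
    finally show ?thesis
      using zero by (simp add: power_red_exp[OF p])
  qed
  then have roots: "{x. poly f x = 0} = UNIV"
    by simp
  have "degree f \<le> p"
    unfolding f_def by (rule degree_sum_le) (auto intro: order.trans[OF degree_monom_le])
  have "f = 0"
  proof (rule ccontr)
    assume "f \<noteq> 0"
    then have "CARD('a) \<le> degree f"
      using card_poly_roots_bound[of f] roots by simp
    then show False
      using \<open>degree f \<le> p\<close> \<open>p > 0\<close> p by simp
  qed
  then have "coeff f r = 0"
    by simp
  moreover have "coeff f r = (if r \<le> p then s r else 0)"
    by (simp add: f_def coeff_sum)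
  moreover have "s r = 0" if "\<not> r \<le> p"
  proof -
    have "{m \<in> K. red_exp p (e m) = r} = {}"
      using le that by auto
    then show ?thesis
      unfolding s_def by (simp only: sum.empty)
  qed
  ultimately show ?thesis
    by (auto simp: s_def split: if_splits)
qed

section \<open>Monomials, evaluation and orbits\<close>

definition exp4 :: "nat \<Rightarrow> nat \<Rightarrow> nat \<Rightarrow> nat \<Rightarrow> (4 \<Rightarrow>\<^sub>0 nat)" where
  "exp4 a b c d = Poly_Mapping.single 1 a + Poly_Mapping.single 2 b
    + Poly_Mapping.single 3 c + Poly_Mapping.single 4 d"

lemma lookup_exp4 [simp]:
  "Poly_Mapping.lookup (exp4 a b c d) 1 = a" "Poly_Mapping.lookup (exp4 a b c d) 2 = b"
  "Poly_Mapping.lookup (exp4 a b c d) 3 = c" "Poly_Mapping.lookup (exp4 a b c d) 4 = d"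
  by (simp_all add: exp4_def lookup_add lookup_single)

lemma exp4_lookup:
  "exp4 (Poly_Mapping.lookup m 1) (Poly_Mapping.lookup m 2)
    (Poly_Mapping.lookup m 3) (Poly_Mapping.lookup m 4) = m"
proof (rule poly_mapping_eqI)
  fix i :: 4
  show "Poly_Mapping.lookup (exp4 (Poly_Mapping.lookup m 1) (Poly_Mapping.lookup m 2)
      (Poly_Mapping.lookup m 3) (Poly_Mapping.lookup m 4)) i = Poly_Mapping.lookup m i"
    using exhaust_4[of i] by auto
qed

lemma Var_power: "Var i ^ n = Poly_Mapping.single (Poly_Mapping.single i n) 1"
  by (induction n) (simp_all add: Var_def mult_single single_add[symmetric])

lemma Var_mon:
  "Var 1 ^ a * Var 2 ^ b * Var 3 ^ c * Var 4 ^ d = Poly_Mapping.single (exp4 a b c d) 1"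
  by (simp add: Var_power mult_single exp4_def)

lemma single_sum:
  "Poly_Mapping.single k (\<Sum>i\<in>A. f i) = (\<Sum>i\<in>A. Poly_Mapping.single k (f i))"
  by (induction A rule: infinite_finite_induct) (simp_all add: single_add)

lemma eval4_diff_single:
  "eval4 (Poly_Mapping.single m 1 - Poly_Mapping.single m' 1) P =
    (\<Prod>i\<in>UNIV. P $ i ^ Poly_Mapping.lookup m i) - (\<Prod>i\<in>UNIV. P $ i ^ Poly_Mapping.lookup m' i)"
proof (cases "m = m'")
  case False
  then have "Poly_Mapping.keys (Poly_Mapping.single m (1::'a) - Poly_Mapping.single m' 1) = {m, m'}"
    by (auto simp: in_keys_iff lookup_minus lookup_single when_def split: if_splits)
  then show ?thesis
    using False by (simp add: eval4_def lookup_minus lookup_single)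
qed (simp add: eval4_def)

lemma homogeneous_diff_single:
  assumes "monom_degree l m = monom_degree l m'"
  shows "homogeneous l (Poly_Mapping.single m 1 - Poly_Mapping.single m' 1)"
  unfolding homogeneous_def using assms
  by (intro exI[of _ "monom_degree l m"])
    (auto simp: in_keys_iff lookup_minus lookup_single when_def split: if_splits)

lemma G_orbit_self: "P \<in> G_orbit l P"
proof -
  have "vector [1, 1, 1, 1 ^ l * 1] = (1 :: 'a alg_closure ^ 4)"
    by (simp add: vec_eq_iff vector_def forall_4)
  then have "1 \<in> (group_G l :: ('a alg_closure ^ 4) set)"
    unfolding group_G_def by (smt (verit) mem_Collect_eq one_neq_zero)
  then show ?thesis
    unfolding G_orbit_def by (metis (mono_tags, lifting) mem_Collect_eq mult_1)
qed

lemma eval4_embed_point: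
  "eval4 F (embed_point P) = to_ac (\<Sum>m\<in>Poly_Mapping.keys F.
    Poly_Mapping.lookup F m * (\<Prod>i\<in>UNIV. P $ i ^ Poly_Mapping.lookup m i))"
  by (simp add: eval4_def embed_point_def to_ac_sum to_ac_prod)

text \<open>Reduces the condition on points over the closure to rational points: every point
  concerned shares its orbit with a rational one.\<close>

lemma vanishing_on_A4_G_iff:
  fixes F :: "'a::field poly4"
  assumes "homogeneous l F"
  shows "(\<forall>P. G_orbit l P \<in> A4_G l \<longrightarrow> eval4 F P = 0) \<longleftrightarrow> (\<forall>P. eval4 F (embed_point P) = 0)"
proof
  assume "\<forall>P. G_orbit l P \<in> A4_G l \<longrightarrow> eval4 F P = 0"
  then show "\<forall>P. eval4 F (embed_point P) = 0"
    by (auto simp: A4_G_def)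
next
  assume zero: "\<forall>P. eval4 F (embed_point P) = 0"
  show "\<forall>P. G_orbit l P \<in> A4_G l \<longrightarrow> eval4 F P = 0"
  proof (intro allI impI)
    fix P :: "'a alg_closure ^ 4"
    assume "G_orbit l P \<in> A4_G l"
    then obtain Q where "G_orbit l P = G_orbit l (embed_point Q)"
      by (auto simp: A4_G_def)
    then have "P \<in> G_orbit l (embed_point Q)"
      using G_orbit_self by blast
    then show "eval4 F P = 0"
      using vanishing_depends_on_orbit[OF assms] zero by blast
  qed
qed

section \<open>Linear independence in four variables\<close>

lemma vanishing_sum_over_class_eq_0:
  fixes F :: "'a::{field, finite} poly4"
  assumes p: "p = CARD('a) - 1" and zero: "\<And>P. eval4 F (embed_point P) = 0"
  shows "(\<Sum>m | m \<in> Poly_Mapping.keys F \<and> (\<forall>i. red_exp p (Poly_Mapping.lookup m i) = r i).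
    Poly_Mapping.lookup F m) = 0"
proof -
  let ?e = "\<lambda>i m. Poly_Mapping.lookup m (i::4)"
  let ?c = "Poly_Mapping.lookup F"
  define K where "K = Poly_Mapping.keys F"
  define K4 where "K4 = {m \<in> K. red_exp p (?e 4 m) = r 4}"
  define K3 where "K3 = {m \<in> K4. red_exp p (?e 3 m) = r 3}"
  define K2 where "K2 = {m \<in> K3. red_exp p (?e 2 m) = r 2}"
  have fin: "finite K" "finite K4" "finite K3" "finite K2"
    by (simp_all add: K_def K4_def K3_def K2_def)
  have "(\<Sum>m\<in>K. ?c m * x1 ^ ?e 1 m * x2 ^ ?e 2 m * x3 ^ ?e 3 m * x4 ^ ?e 4 m) = 0"
    for x1 x2 x3 x4
    using zero[of "vector [x1, x2, x3, x4]"]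
    by (simp add: eval4_embed_point prod_UNIV_4 K_def vector_def mult.assoc)
  \<comment> \<open>With the other variables fixed, their powers belong to the coefficients
    \<open>h\<close> of the one-variable lemma. Each application removes one variable and fixes its
    class.\<close>
  then have "(\<Sum>m\<in>K4. ?c m * x1 ^ ?e 1 m * x2 ^ ?e 2 m * x3 ^ ?e 3 m) = 0" for x1 x2 x3
    unfolding K4_def by (rule sum_red_exp_eq_0[OF p fin(1)])
  then have "(\<Sum>m\<in>K3. ?c m * x1 ^ ?e 1 m * x2 ^ ?e 2 m) = 0" for x1 x2
    unfolding K3_def by (rule sum_red_exp_eq_0[OF p fin(2)])
  then have "(\<Sum>m\<in>K2. ?c m * x1 ^ ?e 1 m) = 0" for x1
    unfolding K2_def by (rule sum_red_exp_eq_0[OF p fin(3)])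
  then have "(\<Sum>m | m \<in> K2 \<and> red_exp p (?e 1 m) = r 1. ?c m) = 0"
    by (rule sum_red_exp_eq_0[OF p fin(4)])
  moreover have "{m \<in> K2. red_exp p (?e 1 m) = r 1} =
      {m \<in> Poly_Mapping.keys F. \<forall>i. red_exp p (?e i m) = r i}"
    by (auto simp: K_def K4_def K3_def K2_def forall_4)
  ultimately show ?thesis
    by simp
qed

section \<open>Equality of the two ideals\<close>

theorem theorem5p1:
  fixes l q :: nat and x1 x2 x3 x4 f1 f2 f3 :: "'a::{field, finite} poly4"
  assumes "l > 0"
    and "q = CARD('a)"
    and "x1 = Var 1" and "x2 = Var 2" and "x3 = Var 3" and "x4 = Var 4"
    and "f1 = x3 ^ (q - 1) - x1 ^ (q - 1)"
    and "f2 = x4 ^ (q - 1) - x2 ^ (q - 1) * x1 ^ ((q - 1) * l)"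
    and "f3 = x4 ^ (q - 1) - x3 ^ ((q - 1) * l) * x2 ^ (q - 1)"
  shows "vanishing_ideal l (A4_G l) =
    ideal_generated {x3 * x1 * f1, x4 * x2 * x1 * f2, x4 * x3 * x2 * f3}"
proof -
  define p where "p = q - 1"
  define B where "B = {x3 * x1 * f1, x4 * x2 * x1 * f2, x4 * x3 * x2 * f3}"
  define V where "V = {F :: 'a poly4. homogeneous l F \<and>
    (\<forall>P. G_orbit l P \<in> A4_G l \<longrightarrow> eval4 F P = 0)}"
  have p: "p = CARD('a) - 1"
    by (simp add: p_def assms)
  have mon: "Poly_Mapping.single (exp4 a b c d) 1 = x1 ^ a * x2 ^ b * x3 ^ c * x4 ^ d" for a b c d
    unfolding assms by (simp only: Var_mon)
  \<comment> \<open>Each generator is a difference of two monomials of the same degree.\<close>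
  have gens:
    "x3 * x1 * f1 = Poly_Mapping.single (exp4 1 0 (1 + p) 0) 1
      - Poly_Mapping.single (exp4 (1 + p) 0 1 0) 1"
    "x4 * x2 * x1 * f2 = Poly_Mapping.single (exp4 1 1 0 (1 + p)) 1
      - Poly_Mapping.single (exp4 (1 + p * l) (1 + p) 0 1) 1"
    "x4 * x3 * x2 * f3 = Poly_Mapping.single (exp4 0 1 1 (1 + p)) 1
      - Poly_Mapping.single (exp4 0 (1 + p) (1 + p * l) 1) 1"
    unfolding mon assms(7-9) p_def by (simp_all add: algebra_simps)
  \<comment> \<open>The extra factor \<open>y\<close> makes the identity hold at
    \<open>y = 0\<close> too; the monomials in front of \<open>f1\<close>, \<open>f2\<close>,
    \<open>f3\<close> supply it.\<close>
  have fermat: "y ^ (p * k) * y = y" for y :: 'a and k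
    using power_card_minus_1_eq_1[of y] p by (cases "y = 0") (simp_all add: power_mult)
  have B_sub: "B \<subseteq> V"
  proof -
    have hom: "homogeneous l F" if "F \<in> B" for F
      using that unfolding B_def gens
      by (elim insertE emptyE; hypsubst; intro homogeneous_diff_single)
        (simp_all add: monom_degree_def algebra_simps)
    moreover have "eval4 F (embed_point P) = 0" if "F \<in> B" for F P
    proof -
      have e: "embed_point P $ i * embed_point P $ i ^ p = embed_point P $ i"
        "embed_point P $ i * embed_point P $ i ^ (p * k) = embed_point P $ i" for i k
        using fermat[of "P $ i" 1] fermat[of "P $ i" k]
        by (simp_all add: embed_point_def mult.commute flip: to_ac_power to_ac_mult)
      show ?thesis
        using that unfolding B_def gens
        by (auto simp: eval4_diff_single prod_UNIV_4 e)
    qed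
    ultimately show ?thesis
      unfolding V_def using vanishing_on_A4_G_iff by blast
  qed
  have V_sub: "F \<in> ideal_generated B" if "F \<in> V" for F
  proof -
    let ?X = "\<lambda>m. Poly_Mapping.single m (1::'a)"
    let ?C = "\<lambda>m. Poly_Mapping.single 0 (Poly_Mapping.lookup F m)"
    define K where "K = Poly_Mapping.keys F"
    define cls where "cls m i = red_exp p (Poly_Mapping.lookup m i)" for m and i :: 4
    \<comment> \<open>One monomial of \<open>F\<close> is chosen in each class. Being a monomial of
      \<open>F\<close>, it has the common degree \<open>D\<close>.\<close>
    define rep where "rep r = (SOME m. m \<in> K \<and> cls m = r)" for r
    obtain D where D: "\<And>m. m \<in> K \<Longrightarrow> monom_degree l m = D"
      using \<open>F \<in> V\<close> by (auto simp: V_def homogeneous_def K_def)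
    have zero: "eval4 F (embed_point P) = 0" for P
      using \<open>F \<in> V\<close> vanishing_on_A4_G_iff by (auto simp: V_def)
    have rep: "rep (cls m) \<in> K \<and> cls (rep (cls m)) = cls m" if "m \<in> K" for m
      unfolding rep_def by (rule someI[of _ m]) (use that in simp)
    have diff: "?X m - ?X (rep (cls m)) \<in> ideal_generated B" if "m \<in> K" for m
    proof -
      define m' where "m' = rep (cls m)"
      have "cls m i = cls m' i" for i
        using rep[OF that] by (simp add: m'_def)
      moreover have "monom_degree l m = monom_degree l m'"
        using D that rep[OF that] by (simp add: m'_def)
      ultimately have "?X (exp4 (Poly_Mapping.lookup m 1) (Poly_Mapping.lookup m 2)
            (Poly_Mapping.lookup m 3) (Poly_Mapping.lookup m 4))
          - ?X (exp4 (Poly_Mapping.lookup m' 1) (Poly_Mapping.lookup m' 2)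
            (Poly_Mapping.lookup m' 3) (Poly_Mapping.lookup m' 4)) \<in> ideal_generated B"
        unfolding mon B_def assms(7-9) p_def[symmetric] cls_def monom_degree_def prod.inject
        by (intro mon_diff_in_ideal \<open>l > 0\<close>) (simp_all flip: of_nat_add of_nat_mult)
      then show ?thesis
        by (simp add: exp4_lookup m'_def)
    qed
    \<comment> \<open>Replacing every monomial of \<open>F\<close> by its representative gives zero,
      because each representative is then multiplied by the coefficient sum of its class.\<close>
    have "(\<Sum>m\<in>K. ?C m * ?X (rep (cls m))) =
        (\<Sum>r\<in>cls ` K. \<Sum>m | m \<in> K \<and> cls m = r. ?C m * ?X (rep (cls m)))"
      by (rule sum.group[symmetric]) (auto simp: K_def)
    also have "\<dots> = (\<Sum>r\<in>cls ` K.
        Poly_Mapping.single 0 (\<Sum>m | m \<in> K \<and> cls m = r. Poly_Mapping.lookup F m) * ?X (rep r))"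
      by (simp add: single_sum sum_distrib_right)
    also have "\<dots> = 0"
      using vanishing_sum_over_class_eq_0[OF p zero]
      by (simp add: K_def cls_def fun_eq_iff)
    finally have "(\<Sum>m\<in>K. ?C m * ?X (rep (cls m))) = 0" .
    moreover have "F = (\<Sum>m\<in>K. ?C m * ?X m)"
    proof (rule poly_mapping_eqI)
      fix m
      show "Poly_Mapping.lookup F m = Poly_Mapping.lookup (\<Sum>m\<in>K. ?C m * ?X m) m"
        by (auto simp: mult_single lookup_sum lookup_single K_def when_def in_keys_iff)
    qed
    \<comment> \<open>Subtracting this zero sum writes \<open>F\<close> as a combination of the
      differences in \<open>diff\<close>.\<close>
    ultimately have "F = (\<Sum>m\<in>K. ?C m * (?X m - ?X (rep (cls m))))"
      by (simp add: right_diff_distrib sum_subtractf)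
    moreover have "\<dots> \<in> ideal_generated B"
      using diff by (intro ideal_sum ideal_scale)
    ultimately show ?thesis
      by simp
  qed
  have "ideal_generated V = ideal_generated B"
    using V_sub ideal_minimal[of V B] ideal_mono[OF B_sub] by blast
  then show ?thesis
    by (simp add: vanishing_ideal_def V_def B_def)
qed

end
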